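(* Fix an even integer $k\ge0$ and let $(x_n)_{n\ge1}$ be the sequence of positive integers defined by $x_{n+2}=\varphi(x_{n+1})+\varphi(x_n)+k$ for all $n\in\mathbb{N}$, with starting values $x_1,x_2\in\mathbb{N}$, where $\varphi$ is Euler's totient function. Then $$\sup_{n\in\mathbb{N}}x_n\le 4^{X^{3^{k+1}}},\qquad\text{where } X:=\frac{3x_1+5x_2+7k}{2}.$$ In particular, $(x_n)_{n\ge1}$ is eventually periodic (i.e., there exists $T\in\mathbb{N}$ with $x_{n+T}=x_n$ for all sufficiently large $n$).
   Context: $\mathbb{N}$ denotes the set of positive integers; $\varphi(n)$ is the number of integers in $\{1,\ldots,n\}$ coprime to $n$. *)

theory Defs
  imports Complex_Main "HOL-Library.Extended_Real" "HOL-Number_Theory.Totient"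
begin

end

theory Submission
  imports Defs "HOL-Analysis.Harmonic_Numbers"
begin

text \<open>
  From \<open>n = 5\<close> on all terms are even, so write \<open>x\<^sub>n = 2y\<^sub>n\<close>, \<open>d\<^sub>n = y\<^sub>n\<^sub>+\<^sub>1 - y\<^sub>n\<close> and
  \<open>\<phi>(2y\<^sub>n) = y\<^sub>n - l\<^sub>n\<close> with a loss \<open>l\<^sub>n \<ge> 0\<close>. Then \<open>2d\<^sub>n\<^sub>+\<^sub>1 + d\<^sub>n = k - l\<^sub>n - l\<^sub>n\<^sub>+\<^sub>1 \<le> k\<close>, and the
  potential \<open>U\<^sub>n = 3y\<^sub>n + 2d\<^sub>n + 2\<bar>d\<^sub>n\<bar>\<close> satisfies \<open>U\<^sub>n\<^sub>+\<^sub>1 \<le> U\<^sub>n + 2k - \<bar>d\<^sub>n\<bar>\<close>. If \<open>U\<close> stays above its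
  initial value for \<open>T\<close> steps, then \<open>\<bar>d\<bar>\<close> is at most \<open>2k\<close> on average, the \<open>y\<^sub>n\<close> with \<open>\<bar>d\<^sub>n\<bar> \<le> 4k\<close> lie in
  an interval of length about \<open>2kT/3\<close>, and all losses are \<open>O(kT)\<close>. As a value divisible by an odd
  prime \<open>q\<close> loses at least \<open>y/q\<close>, these \<open>y\<^sub>n\<close> are coprime to any fixed odd \<open>P\<close> once \<open>U\<close> is large.
  Choosing \<open>P\<close> with \<open>\<phi>(P)/P\<close> of order \<open>1/k\<^sup>2\<close> and \<open>T = 9P\<close> leaves fewer than \<open>T\<close> possible states
  \<open>(y\<^sub>n, d\<^sub>n)\<close>, so a state repeats and the sequence is periodic from there on. Hence \<open>U\<close> never
  exceeds the large threshold, or its initial value, by more than \<open>O(kP)\<close>.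
\<close>

section \<open>Counting coprime integers in intervals; totient inequalities\<close>

lemma card_coprime_period:
  "card {y \<in> {a..<a + P}. coprime y P} = totient P"
proof -
  define f :: "nat \<Rightarrow> nat" where "f = (\<lambda>y. if coprime y P then 1 else 0)"
  have card_eq: "card {y \<in> {u..<u + P}. coprime y P} = sum f {u..<u + P}" for u
    by (simp add: f_def sum.If_cases Int_def conj_commute)
  \<comment> \<open>Sliding the window by one exchanges \<open>u\<close> for \<open>u + P\<close>,
    which has the same gcd with \<open>P\<close>.\<close>
  have shift: "sum f {u..<u + P} = sum f {Suc u..<Suc u + P}" for u
  proof (cases "P = 0")
    case False
    have "f (u + P) = f u"
      by (simp add: f_def coprime_iff_gcd_eq_1)
    moreover have "sum f {u..<u + P} = f u + sum f {Suc u..<u + P}"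
      using False by (intro sum.atLeast_Suc_lessThan) simp
    moreover have "sum f {Suc u..<Suc u + P} = sum f {Suc u..<u + P} + f (u + P)"
      using False by simp
    ultimately show ?thesis by simp
  qed simp
  have "sum f {a..<a + P} = sum f {0..<0 + P}"
  proof (induction a)
    case (Suc a)
    then show ?case by (simp only: shift[symmetric])
  qed simp
  also have "\<dots> = sum f {1..<1 + P}"
    using shift[of 0] by simp
  also have "\<dots> = card {y \<in> {1..<1 + P}. coprime y P}"
    by (simp only: card_eq)
  also have "{y \<in> {1..<1 + P}. coprime y P} = totatives P"
    by (auto simp: totatives_def)
  finally show ?thesis
    by (simp only: card_eq totient_def)
qed

lemma card_coprime_periods:
  "card {y \<in> {a..<a + P * m}. coprime y P} = m * totient P"
proof (induction m)
  case (Suc m)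
  have "{y \<in> {a..<a + P * Suc m}. coprime y P}
      = {y \<in> {a..<a + P * m}. coprime y P} \<union> {y \<in> {a + P * m..<a + P * m + P}. coprime y P}"
    by auto
  also have "card \<dots> = m * totient P + totient P"
    by (subst card_Un_disjoint) (simp, simp, fastforce, simp only: Suc card_coprime_period)
  finally show ?case by simp
qed simp

text \<open>Numbers coprime to \<open>a * b\<close> are coprime to \<open>b\<close>, and
  \<open>a\<close> full periods modulo \<open>b\<close> make up the range to
  \<open>a * b\<close>.\<close>

lemma totient_mult_le: "totient (a * b) \<le> a * totient b"
proof -
  have "totatives (a * b) \<subseteq> {y \<in> {1..<1 + b * a}. coprime y b}"
    by (auto simp: totatives_def mult.commute)
  then have "totient (a * b) \<le> card {y \<in> {1..<1 + b * a}. coprime y b}"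
    unfolding totient_def by (intro card_mono) auto
  then show ?thesis
    by (simp only: card_coprime_periods)
qed

text \<open>
  Since \<open>\<phi>(N / d) \<ge> \<phi>(N) / d\<close>, this is Gauss's identity \<open>N = \<Sum>\<^bsub>d dvd N\<^esub> \<phi>(N / d)\<close>.
\<close>

lemma totient_sum_inverse_divisors_le:
  assumes "N > 0" and "\<And>d. d \<in> D \<Longrightarrow> d dvd N"
  shows "real (totient N) * (\<Sum>d\<in>D. 1 / real d) \<le> real N"
proof -
  have fin: "finite {d. d dvd N}"
    using assms(1) by simp
  have "real (totient N) * (\<Sum>d\<in>D. 1 / real d) \<le> real (totient N) * (\<Sum>d | d dvd N. 1 / real d)"
    using assms(2) fin by (intro mult_left_mono sum_mono2) auto
  also have "\<dots> = (\<Sum>d | d dvd N. real (totient N) / real d)"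
    by (simp add: sum_distrib_left)
  also have "\<dots> \<le> (\<Sum>d | d dvd N. real (totient (N div d)))"
  proof (rule sum_mono)
    fix d assume "d \<in> {d. d dvd N}"
    then have d: "d dvd N" "d > 0"
      using assms(1) by (auto intro: Nat.gr0I)
    have "totient N \<le> d * totient (N div d)"
      using totient_mult_le[of d "N div d"] d by simp
    then have "real (totient N) \<le> real d * real (totient (N div d))"
      by (metis of_nat_le_iff of_nat_mult)
    then show "real (totient N) / real d \<le> real (totient (N div d))"
      using d by (simp add: field_simps)
  qed
  also have "\<dots> = (\<Sum>d | d dvd N. real (totient d))"
    using assms(1) by (intro sum.reindex_bij_witness[of _ "\<lambda>d. N div d" "\<lambda>d. N div d"]) auto
  also have "\<dots> = real (\<Sum>d | d dvd N. totient d)"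
    by simp
  also have "\<dots> = real N"
    by (simp only: totient_divisor_sum)
  finally show ?thesis .
qed

section \<open>Odd moduli with few coprime residues\<close>

text \<open>The double factorial \<open>(2 m - 1)!!\<close>. All odd numbers below
  \<open>2 m\<close> divide it, so a harmonic sum controls its totient without estimates on
  primes.\<close>

definition odd_prod :: "nat \<Rightarrow> nat" where
  "odd_prod m = (\<Prod>i<m. 2 * i + 1)"

lemma odd_odd_prod: "odd (odd_prod m)"
  unfolding odd_prod_def by (induction m) auto

lemma odd_prod_le: "odd_prod m \<le> (2 * m) ^ m"
proof -
  have "odd_prod m \<le> (\<Prod>i<m. 2 * m)"
    unfolding odd_prod_def by (intro prod_mono) auto
  then show ?thesis by simp
qed

lemma odd_prod_ge: "m \<le> odd_prod m"
proof (cases m)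
  case (Suc n)
  have "2 * n + 1 dvd odd_prod m"
    unfolding odd_prod_def Suc by (simp only: prod.lessThan_Suc dvd_triv_right)
  then have "2 * n + 1 \<le> odd_prod m"
    using odd_odd_prod[of m] by (intro dvd_imp_le) (auto intro: Nat.gr0I)
  then show ?thesis using Suc by simp
qed simp

text \<open>The divisors \<open>1, 3, ..., 2 m - 1\<close> have reciprocal sum at least half of
  \<open>harm m\<close>, hence at least \<open>ln (m + 1) / 2\<close>.\<close>

lemma totient_odd_prod_le: "real (totient (odd_prod m)) * ln (real m + 1) \<le> 2 * real (odd_prod m)"
proof -
  have "ln (real m + 1) \<le> harm m"
    by (rule ln_le_harm)
  also have "harm m = (\<Sum>i<m. 1 / real (Suc i))"
    by (induction m) (simp_all add: harm_expand harm_Suc inverse_eq_divide)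
  also have "\<dots> \<le> (\<Sum>i<m. 2 * (1 / real (2 * i + 1)))"
    by (intro sum_mono) (simp add: field_simps)
  also have "\<dots> = 2 * (\<Sum>d\<in>(\<lambda>i. 2 * i + 1) ` {..<m}. 1 / real d)"
    by (simp add: sum.reindex inj_on_def sum_distrib_left)
  finally have "real (totient (odd_prod m)) * ln (real m + 1)
      \<le> 2 * (real (totient (odd_prod m)) * (\<Sum>d\<in>(\<lambda>i. 2 * i + 1) ` {..<m}. 1 / real d))"
    by (metis mult.left_commute mult_left_mono of_nat_0_le_iff)
  also have "real (totient (odd_prod m)) * (\<Sum>d\<in>(\<lambda>i. 2 * i + 1) ` {..<m}. 1 / real d)
      \<le> real (odd_prod m)"
  proof (rule totient_sum_inverse_divisors_le)
    show "odd_prod m > 0"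
      using odd_odd_prod[of m] by (auto intro: Nat.gr0I)
    show "d dvd odd_prod m" if "d \<in> (\<lambda>i. 2 * i + 1) ` {..<m}" for d
      using that unfolding odd_prod_def by auto
  qed
  finally show ?thesis by simp
qed

section \<open>Loss of the totient at even numbers\<close>

lemma totient_double_le: "totient (2 * y) \<le> y"
  using totient_mult_le[of y 2] by (simp add: mult.commute)

text \<open>For a common prime \<open>q\<close>, necessarily odd, and \<open>y = q * t\<close>, the
  totient of \<open>2 * y\<close> is at most \<open>t * (q - 1) = y - t\<close>, where
  \<open>t = y / q \<ge> y / P\<close>.\<close>

lemma totient_double_not_coprime:
  assumes "y > 0" and "odd P" and "\<not> coprime y P"
  shows "y \<le> P * (y - totient (2 * y))"
proof -
  obtain q where q: "prime q" "q dvd y" "q dvd P"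
    using assms(3) by (metis coprime_iff_gcd_eq_1 gcd_greatest_iff prime_factor_nat)
  then have "odd q"
    using assms(2) dvd_trans by blast
  then have "totient (2 * q) = q - 1"
    using q(1) by (simp add: totient_double totient_prime)
  obtain t where t: "y = q * t"
    using q(2) by blast
  have "totient (2 * y) \<le> t * (q - 1)"
    using totient_mult_le[of t "2 * q"] \<open>totient (2 * q) = q - 1\<close> t by (simp add: ac_simps)
  then have "t \<le> y - totient (2 * y)"
    using t prime_gt_0_nat[OF q(1)] assms(1)
    by (cases q) (auto simp: algebra_simps)
  moreover have "q \<le> P"
    using q(3) assms(2) by (intro dvd_imp_le) (auto intro: Nat.gr0I)
  ultimately show ?thesis
    unfolding t by (meson mult_le_mono)
qed

text \<open>With \<open>N = 4 * k\<close> this is the most weight that one value of \<open>y\<close>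
  can carry in the pigeonhole argument below.\<close>

lemma sum_tent: "(\<Sum>e = - int N..int N. int N - \<bar>e\<bar>) = int N ^ 2"
proof (induction N)
  case (Suc N)
  have "{- int (Suc N)..int (Suc N)} = insert (- int N - 1) (insert (int N + 1) {- int N..int N})"
    by auto
  then have "(\<Sum>e = - int (Suc N)..int (Suc N). int (Suc N) - \<bar>e\<bar>)
      = (\<Sum>e = - int N..int N. (int N - \<bar>e\<bar>) + 1)"
    by (simp add: algebra_simps)
  also have "\<dots> = int N ^ 2 + (2 * int N + 1)"
    by (simp only: sum.distrib Suc) simp
  finally show ?case
    by (simp add: power2_eq_square algebra_simps)
qed simp

section \<open>Second-order recurrences and periodicity\<close>

lemma second_order_recurrence_shift:
  fixes x :: "nat \<Rightarrow> 'a"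
  assumes rec: "\<And>n. n \<ge> n0 \<Longrightarrow> x (n + 2) = F (x n) (x (n + 1))"
    and "n0 \<le> i" "n0 \<le> j" "x i = x j" "x (Suc i) = x (Suc j)"
  shows "x (i + s) = x (j + s)"
proof -
  have "x (i + s) = x (j + s) \<and> x (i + s + 1) = x (j + s + 1)"
  proof (induction s)
    case (Suc s)
    then show ?case
      using rec[of "i + s"] rec[of "j + s"] assms(2,3) by simp
  qed (use assms in simp)
  then show ?thesis ..
qed

lemma second_order_recurrence_eventually_periodic:
  fixes x :: "nat \<Rightarrow> nat"
  assumes rec: "\<And>n. n \<ge> n0 \<Longrightarrow> x (n + 2) = F (x n) (x (n + 1))"
    and bound: "\<And>n. n \<ge> n0 \<Longrightarrow> x n \<le> B"
  shows "\<exists>T\<ge>1. \<forall>\<^sub>F n in sequentially. x (n + T) = x n"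
proof -
  have "(\<lambda>n. (x n, x (Suc n))) ` {n0..} \<subseteq> {..B} \<times> {..B}"
    using bound by auto
  then have "finite ((\<lambda>n. (x n, x (Suc n))) ` {n0..})"
    by (rule finite_subset) simp
  then have "\<not> inj_on (\<lambda>n. (x n, x (Suc n))) {n0..}"
    using finite_imageD infinite_Ici by blast
  then obtain i j where ij: "n0 \<le> i" "i < j" "x i = x j" "x (Suc i) = x (Suc j)"
    by (auto simp: inj_on_def) (metis linorder_neqE_nat)
  have "x (n + (j - i)) = x n" if "n \<ge> i" for n
    using second_order_recurrence_shift[of n0 x F i j "n - i", OF rec] ij that
    by (simp add: add.commute)
  then show ?thesis
    using ij(2) by (intro exI[of _ "j - i"]) (auto simp: eventually_sequentially)
qed

section \<open>The halved recurrence and its potential\<close>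

locale halved_recurrence =
  fixes k :: nat and y :: "nat \<Rightarrow> nat"
  assumes y_pos: "y n > 0"
    and y_rec: "2 * y (n + 2) = totient (2 * y (n + 1)) + totient (2 * y n) + k"
begin

definition d :: "nat \<Rightarrow> int" where
  "d n = int (y (Suc n)) - int (y n)"

definition loss :: "nat \<Rightarrow> int" where
  "loss n = int (y n) - int (totient (2 * y n))"

text \<open>Equals \<open>3 y\<close> if \<open>d \<le> 0\<close> and \<open>3 y + 4 d\<close>
  otherwise: a positive difference pays in advance for later growth.\<close>

definition U :: "nat \<Rightarrow> int" where
  "U n = 3 * int (y n) + 2 * d n + 2 * \<bar>d n\<bar>"

lemma loss_nonneg: "loss n \<ge> 0"
  using totient_double_le[of "y n"] by (simp add: loss_def)

lemma d_Suc: "2 * d (Suc n) + d n = int k - loss n - loss (Suc n)"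
proof -
  have "2 * int (y (Suc (Suc n))) = int (totient (2 * y (Suc n))) + int (totient (2 * y n)) + int k"
    using arg_cong[OF y_rec[of n], of int] by simp
  then show ?thesis
    by (simp add: d_def loss_def)
qed

text \<open>Let \<open>d'\<close> be the next difference. If \<open>d' \<ge> 0\<close>, then
  \<open>2 d' \<le> k - d\<close> makes the new potential at most \<open>3 y + d + 2 k\<close>; if
  \<open>d' < 0\<close>, it is \<open>3 y + 3 d\<close>. Both are at most
  \<open>3 y + 2 d + \<bar>d\<bar> + 2 k\<close>.\<close>

lemma U_Suc: "U (Suc n) \<le> U n + 2 * int k - \<bar>d n\<bar>"
proof -
  have "int (y (Suc n)) = int (y n) + d n"
    by (simp add: d_def)
  moreover have "2 * d (Suc n) + d n \<le> int k"
    using d_Suc[of n] loss_nonneg[of n] loss_nonneg[of "Suc n"] by linarith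
  ultimately show ?thesis
    using of_nat_0_le_iff[of k, where 'a = int] unfolding U_def by linarith
qed

lemma U_add: "U (n + t) \<le> U n + 2 * int k * int t - (\<Sum>j<t. \<bar>d (n + j)\<bar>)"
proof (induction t)
  case (Suc t)
  then show ?case
    using U_Suc[of "n + t"] by (simp add: algebra_simps)
qed simp

lemma U_add_le: "U (n + t) \<le> U n + 2 * int k * int t"
proof -
  have "(\<Sum>j<t. \<bar>d (n + j)\<bar>) \<ge> 0"
    by (intro sum_nonneg) simp
  then show ?thesis
    using U_add[of n t] by linarith
qed

lemma y_le_U: "2 * int (y n) \<le> U n"
  unfolding U_def by linarith

lemma loss_not_coprime:
  assumes "odd P" and "\<not> coprime (y n) P"
  shows "int (y n) \<le> int P * loss n"
proof -
  have "y n \<le> P * (y n - totient (2 * y n))"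
    by (rule totient_double_not_coprime[OF y_pos assms])
  then have "int (y n) \<le> int (P * (y n - totient (2 * y n)))"
    by (simp only: of_nat_le_iff)
  also have "\<dots> = int P * loss n"
    using totient_double_le[of "y n"] by (simp add: loss_def of_nat_diff)
  finally show ?thesis .
qed

lemma y_shift:
  assumes "y i = y j" and "y (Suc i) = y (Suc j)"
  shows "y (i + s) = y (j + s)"
proof (rule second_order_recurrence_shift[of 0 y])
  show "y (n + 2) = (totient (2 * y (n + 1)) + totient (2 * y n) + k) div 2" for n
    using y_rec[of n] by linarith
qed (use assms in simp_all)

text \<open>Weighted pigeonhole: step \<open>j\<close> gets weight
  \<open>4 k - \<bar>d\<bar>\<close>. As \<open>\<bar>d\<bar>\<close> is at most \<open>2 k\<close>
  on average, the weights total at least \<open>2 k T\<close>. Only steps in \<open>J\<close> have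
  nonnegative weight, and their values lie in \<open>S\<close>. Without a repeated state each value
  in \<open>S\<close> carries at most \<open>(4 k)^2\<close>, which by \<open>density\<close> adds
  up to less than \<open>2 k T\<close>.\<close>

lemma long_excursion_repeats:
  assumes k: "k > 0" and P: "odd P" "16 * k + 2 < 3 * P"
    and density: "8 * k * (6 * k + 1) * totient P < 9 * P"
    and start: "U n \<ge> 140 * int k * int P ^ 2"
    and excursion: "\<And>j. j \<le> 9 * P + 1 \<Longrightarrow> U n \<le> U (n + j)"
  shows "\<not> inj_on (\<lambda>j. (y (n + j), d (n + j))) {..<9 * P}"
proof
  assume inj: "inj_on (\<lambda>j. (y (n + j), d (n + j))) {..<9 * P}"
  define T where "T = 9 * P"
  define J where "J = {j \<in> {..<T}. \<bar>d (n + j)\<bar> \<le> 4 * int k}"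
  define f where "f = (\<lambda>j. (y (n + j), d (n + j)))"
  \<comment> \<open>In \<open>J\<close>, \<open>2 d + 2 \<bar>d\<bar> \<le> 16 k\<close>, so
    \<open>3 y \<ge> U n - 16 k\<close>, while \<open>U_add_le\<close> gives
    \<open>3 y \<le> U n + 18 k P\<close>. The slack \<open>16 k + 2\<close>, with 2 from rounding,
    is below \<open>3 P\<close>, so \<open>6 k + 1\<close> periods of \<open>P\<close>
    suffice.\<close>
  define a where "a = nat ((U n - 16 * int k) div 3)"
  define S where "S = {s \<in> {a..<a + P * (6 * k + 1)}. coprime s P}"
  \<comment> \<open>\<open>T + 1\<close> is allowed because the loss at a step \<open>j < T\<close>
    also involves the difference at \<open>j + 1\<close>.\<close>
  have sum_d: "(\<Sum>j<t. \<bar>d (n + j)\<bar>) \<le> 2 * int k * int t" if "t \<le> T + 1" for t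
    using U_add[of n t] excursion[of t] that by (simp add: T_def)
  have P_pos: "P \<ge> 7"
    using k P(2) by linarith
  \<comment> \<open>A value not coprime to \<open>P\<close> is at most \<open>P\<close> times its
    loss, and the loss will be at most \<open>5 k + 36 k P\<close>;
    \<open>3 y \<ge> U n - 16 k\<close> has to exceed three times that product.\<close>
  have start': "U n > 16 * int k + 3 * (int P * (5 * int k + 36 * int k * int P))"
  proof -
    have "16 * int k + 3 * (int P * (5 * int k + 36 * int k * int P))
        = int k * (16 + 15 * int P + 108 * int P ^ 2)"
      by (simp add: algebra_simps power2_eq_square)
    also have "\<dots> < int k * (140 * int P ^ 2)"
    proof (rule mult_strict_left_mono)
      have "7 * int P \<le> int P * int P"
        using P_pos by (intro mult_right_mono) auto
      then show "16 + 15 * int P + 108 * int P ^ 2 < 140 * int P ^ 2"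
        using P_pos unfolding power2_eq_square by linarith
    qed (use k in simp)
    finally show ?thesis
      using start by (simp add: algebra_simps)
  qed
  have in_S: "y (n + j) \<in> S" if j: "j \<in> J" for j
  proof -
    have jT: "j < T" and dj: "\<bar>d (n + j)\<bar> \<le> 4 * int k"
      using j by (auto simp: J_def)
    have lower: "U n - 16 * int k \<le> 3 * int (y (n + j))"
      using excursion[of j] jT dj unfolding U_def[of "n + j"] T_def by (simp; linarith)
    have "U (n + j) \<le> U n + 2 * int k * int j"
      by (rule U_add_le)
    moreover have "2 * int k * int j \<le> 2 * int k * int T"
      using jT by (intro mult_left_mono) auto
    ultimately have upper: "3 * int (y (n + j)) \<le> U n + 18 * (int k * int P)"
      unfolding U_def[of "n + j"] T_def by (simp add: algebra_simps; linarith)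
    have int_a: "int a = (U n - 16 * int k) div 3"
    proof -
      have "0 \<le> 3 * (int P * (5 * int k + 36 * int k * int P))"
        by simp
      then have "U n - 16 * int k \<ge> 0"
        using start' by linarith
      then show ?thesis
        by (simp add: a_def)
    qed
    have "int a \<le> int (y (n + j))"
      using lower unfolding int_a by linarith
    moreover have "3 * (int (y (n + j)) - int a) < 3 * (int P * (6 * int k + 1))"
    proof -
      have "3 * int a \<ge> U n - 16 * int k - 2"
        unfolding int_a by linarith
      moreover have "16 * int k + 2 < 3 * int P"
        using P(2) by linarith
      ultimately show ?thesis
        using upper by (simp add: algebra_simps)
    qed
    then have "int (y (n + j)) < int (a + P * (6 * k + 1))"
      by (simp add: algebra_simps)
    then have "y (n + j) < a + P * (6 * k + 1)"
      by (simp only: of_nat_less_iff)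
    moreover have "coprime (y (n + j)) P"
    proof (rule ccontr)
      assume "\<not> coprime (y (n + j)) P"
      then have "int (y (n + j)) \<le> int P * loss (n + j)"
        using P(1) by (intro loss_not_coprime)
      also have "\<dots> \<le> int P * (5 * int k + 36 * int k * int P)"
      proof (rule mult_left_mono)
        \<comment> \<open>By \<open>d_Suc\<close> the loss is at most \<open>k\<close> plus twice
          these two terms of the sum, that is \<open>k + 2 (18 k P + 2 k)\<close>.\<close>
        have "(\<Sum>i\<in>{j, Suc j}. \<bar>d (n + i)\<bar>) \<le> (\<Sum>i<T + 1. \<bar>d (n + i)\<bar>)"
          using jT by (intro sum_mono2) auto
        also have "\<dots> \<le> 2 * int k * int (T + 1)"
          by (rule sum_d) simp
        finally have "\<bar>d (n + j)\<bar> + \<bar>d (Suc (n + j))\<bar> \<le> 18 * (int k * int P) + 2 * int k"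
          by (simp add: T_def algebra_simps)
        then show "loss (n + j) \<le> 5 * int k + 36 * int k * int P"
          using d_Suc[of "n + j"] loss_nonneg[of "Suc (n + j)"]
          by (simp add: algebra_simps; linarith)
      qed simp
      finally show False
        using lower start' by linarith
    qed
    ultimately show ?thesis
      unfolding S_def by simp
  qed
  have card_S: "card S = (6 * k + 1) * totient P"
    unfolding S_def by (rule card_coprime_periods)
  have fin_S: "finite S"
    unfolding S_def by simp
  have "2 * int k * int T = (\<Sum>j<T. 4 * int k) - 2 * int k * int T"
    by simp
  also have "\<dots> \<le> (\<Sum>j<T. 4 * int k) - (\<Sum>j<T. \<bar>d (n + j)\<bar>)"
    using sum_d[OF le_add1] by linarith
  also have "\<dots> = (\<Sum>j<T. 4 * int k - \<bar>d (n + j)\<bar>)"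
    by (simp only: sum_subtractf)
  also have "\<dots> \<le> (\<Sum>j<T. if j \<in> J then 4 * int k - \<bar>d (n + j)\<bar> else 0)"
    by (intro sum_mono) (auto simp: J_def)
  also have "\<dots> = (\<Sum>j\<in>J. 4 * int k - \<bar>d (n + j)\<bar>)"
    by (intro sum.mono_neutral_cong_right) (auto simp: J_def)
  also have "\<dots> = (\<Sum>p\<in>f ` J. 4 * int k - \<bar>snd p\<bar>)"
  proof -
    have "inj_on f J"
      using inj unfolding f_def by (rule inj_on_subset) (auto simp: J_def T_def)
    then show ?thesis
      by (simp add: sum.reindex f_def)
  qed
  also have "\<dots> \<le> (\<Sum>p\<in>S \<times> {- int (4 * k)..int (4 * k)}. 4 * int k - \<bar>snd p\<bar>)"
  proof (rule sum_mono2)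
    show "f ` J \<subseteq> S \<times> {- int (4 * k)..int (4 * k)}"
      using in_S by (auto simp: f_def J_def)
  qed (use fin_S in auto)
  also have "\<dots> = (\<Sum>s\<in>S. \<Sum>e = - int (4 * k)..int (4 * k). int (4 * k) - \<bar>e\<bar>)"
    unfolding sum.cartesian_product by (simp add: split_def)
  also have "\<dots> = int (card S) * int (4 * k) ^ 2"
    by (simp only: sum_tent sum_constant)
  also have "\<dots> = int (2 * k * (8 * k * (6 * k + 1) * totient P))"
    unfolding card_S by (simp add: power2_eq_square algebra_simps)
  also have "\<dots> < int (2 * k * (9 * P))"
    using density k by (simp only: of_nat_less_iff mult_less_cancel1) simp
  also have "\<dots> = 2 * int k * int T"
    by (simp add: T_def)
  finally show False by simp
qed

text \<open>Let \<open>t\<close> be the first time above the bound and \<open>g\<close> the last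
  time up to \<open>t\<close> with \<open>U g \<le> C\<close>. Climbing at most \<open>2 k\<close>
  per step takes more than \<open>W\<close> steps, so a state repeats between \<open>g\<close> and
  \<open>t\<close>. Going back from \<open>t\<close> by the period gives an earlier time with the
  same \<open>U\<close>, against minimality.\<close>

lemma U_bounded:
  assumes k: "k > 0" and P: "odd P" "16 * k + 2 < 3 * P"
    and density: "8 * k * (6 * k + 1) * totient P < 9 * P"
    and C: "U 0 \<le> C" "140 * int k * int P ^ 2 + 2 * int k \<le> C"
  shows "U n \<le> C + 2 * int k * int (9 * P + 1)"
proof (rule ccontr)
  define W where "W = 9 * P + 1"
  assume "\<not> ?thesis"
  then have ex: "\<exists>t. U t > C + 2 * int k * int W"
    unfolding W_def by (intro exI[of _ n]) simp
  define t where "t = (LEAST t. U t > C + 2 * int k * int W)"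
  have t: "U t > C + 2 * int k * int W"
    unfolding t_def by (rule LeastI_ex) (rule ex)
  have t_least: "U s \<le> C + 2 * int k * int W" if "s < t" for s
    using not_less_Least[of s "\<lambda>t. U t > C + 2 * int k * int W"] that
    unfolding t_def[symmetric] by simp
  define g where "g = (GREATEST g. g \<le> t \<and> U g \<le> C)"
  have g: "g \<le> t \<and> U g \<le> C"
    unfolding g_def by (rule GreatestI_nat[of _ 0 t]) (use C in auto)
  have g_greatest: "s \<le> g" if "s \<le> t" "U s \<le> C" for s
    unfolding g_def by (rule Greatest_le_nat[of _ _ t]) (use that in auto)
  have "t > g + W"
  proof (rule ccontr)
    assume "\<not> t > g + W"
    then have "2 * int k * int (t - g) \<le> 2 * int k * int W"
      by (intro mult_left_mono) auto
    then show False
      using U_add_le[of g "t - g"] g t by simp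
  qed
  have above: "U s > C" if "g < s" "s \<le> t" for s
    using g_greatest[of s] that by linarith
  have "\<not> inj_on (\<lambda>j. (y (g + j), d (g + j))) {..<9 * P}"
  proof (rule long_excursion_repeats[OF k P density])
    \<comment> \<open>One step raises \<open>U\<close> by at most \<open>2 k\<close>, so
      \<open>U g > C - 2 k\<close>; the summand \<open>2 k\<close> in the second bound on
      \<open>C\<close> pays for this.\<close>
    have "U (Suc g) > C"
      using above[of "Suc g"] \<open>t > g + W\<close> by simp
    then show "U g \<ge> 140 * int k * int P ^ 2"
      using U_Suc[of g] C(2) by linarith
    show "U g \<le> U (g + j)" if "j \<le> 9 * P + 1" for j
      using above[of "g + j"] g \<open>t > g + W\<close> that by (cases "j = 0") (auto simp: W_def)
  qed
  then obtain i j where ij: "i < j" "j < 9 * P"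
    "y (g + i) = y (g + j)" "d (g + i) = d (g + j)"
    by (auto simp: inj_on_def) (metis linorder_neqE_nat)
  then have "y (Suc (g + i)) = y (Suc (g + j))"
    by (simp add: d_def)
  note shift = y_shift[OF ij(3) this]
  have "U (g + i + s) = U (g + j + s)" for s
    using shift[of s] shift[of "Suc s"] by (simp add: U_def d_def)
  from this[of "t - (g + j)"] have "U (t - (j - i)) = U t"
    using ij \<open>t > g + W\<close> by (simp add: W_def add.commute)
  moreover have "t - (j - i) < t"
    using ij \<open>t > g + W\<close> by simp
  ultimately show False
    using t_least t by fastforce
qed

end

section \<open>Numerical estimates\<close>

text \<open>As \<open>ln 2 \<ge> 2 / 3\<close>, the exponent \<open>18 k^2\<close> gives
  \<open>ln m \<ge> 12 k^2\<close>, so the totient is below \<open>odd_prod m / (6 k^2)\<close>.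
  This suffices because \<open>8 k (6 k + 1) \<le> 54 k^2\<close>.\<close>

lemma odd_prod_density:
  assumes "k \<ge> 2" and "m = 2 ^ (18 * k\<^sup>2)"
  shows "8 * k * (6 * k + 1) * totient (odd_prod m) < 9 * odd_prod m"
proof -
  let ?P = "odd_prod m"
  have pos: "totient ?P > 0"
    using odd_odd_prod[of m] by (auto intro: Nat.gr0I)
  have "12 * real (k\<^sup>2) = real (18 * k\<^sup>2) * (2 / 3)"
    by simp
  also have "\<dots> \<le> real (18 * k\<^sup>2) * ln 2"
    by (intro mult_left_mono ln2_ge_two_thirds) simp
  also have "\<dots> = ln (real m)"
    unfolding assms(2) by (simp add: ln_realpow)
  also have "\<dots> < ln (real m + 1)"
  proof -
    have "m > 0"
      by (simp add: assms(2))
    then show ?thesis by simp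
  qed
  finally have "real (totient ?P) * (12 * real (k\<^sup>2)) < real (totient ?P) * ln (real m + 1)"
    using pos by (intro mult_strict_left_mono) auto
  also have "\<dots> \<le> 2 * real ?P"
    by (rule totient_odd_prod_le)
  finally have "real (totient ?P * (12 * k\<^sup>2)) < real (2 * ?P)"
    by simp
  then have "totient ?P * (12 * k\<^sup>2) < 2 * ?P"
    by (simp only: of_nat_less_iff)
  then have 1: "54 * k\<^sup>2 * totient ?P < 9 * ?P"
    by (simp add: algebra_simps)
  have "k * 2 \<le> k * k"
    using assms(1) by (intro mult_left_mono) auto
  moreover have "8 * k * (6 * k + 1) = 48 * (k * k) + 8 * k"
    by (simp add: algebra_simps)
  ultimately have "8 * k * (6 * k + 1) \<le> 54 * k\<^sup>2"
    unfolding power2_eq_square by linarith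
  then have "8 * k * (6 * k + 1) * totient ?P \<le> 54 * k\<^sup>2 * totient ?P"
    by (rule mult_right_mono) simp
  with 1 show ?thesis by linarith
qed

lemma le_four_powr: "Y \<le> 4 powr Y" for Y :: real
proof (cases "Y \<ge> 0")
  case True
  have "ln (4::real) = 2 * ln 2"
    using ln_realpow[of 2 2] by simp
  then have "Y * 1 \<le> Y * ln 4"
    using True ln2_ge_two_thirds by (intro mult_left_mono) auto
  also have "\<dots> \<le> exp (Y * ln 4)"
    using exp_ge_add_one_self[of "Y * ln 4"] by linarith
  finally show ?thesis
    by (simp add: powr_def)
next
  case False
  then show ?thesis
    by (smt (verit) powr_ge_zero)
qed

lemma linear_le_four_powr:
  fixes X :: real
  assumes "X \<ge> 4" "c \<le> X\<^sup>2" "e \<ge> 3"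
  shows "c * X \<le> 4 powr (X ^ e)"
proof -
  have "c * X \<le> X\<^sup>2 * X"
    using assms by (intro mult_right_mono) auto
  also have "\<dots> = X ^ 3"
    by (simp add: power2_eq_square power3_eq_cube)
  also have "\<dots> \<le> X ^ e"
    using assms by (intro power_increasing) auto
  also have "\<dots> \<le> 4 powr (X ^ e)"
    by (rule le_four_powr)
  finally show ?thesis .
qed

lemma twenty_square_le_three_power: "k \<ge> 2 \<Longrightarrow> 20 * k\<^sup>2 \<le> (3::nat) ^ (k + 2)"
proof (induction k rule: dec_induct)
  case (step k)
  have "k * 2 \<le> k * k"
    using step by (intro mult_left_mono) auto
  then have "20 * (Suc k)\<^sup>2 \<le> 3 * (20 * k\<^sup>2)"
    using step(1) unfolding power2_eq_square by (simp add: algebra_simps; linarith)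
  then show ?case
    using step by simp
qed simp

lemma linear_le_power_four: "j \<ge> 4 \<Longrightarrow> 18 * j + 3 \<le> (4::nat) ^ j"
  by (induction j rule: dec_induct) auto

text \<open>Each summand is at most half of the right side. For the second,
  \<open>odd_prod m \<le> (2 m)^m\<close> bounds the square by \<open>4\<close> to the power
  \<open>(18 k^2 + 1) m\<close>; the factors \<open>162 k\<close> and \<open>2\<close> cost
  \<open>4 ^ m\<close> each, and \<open>(18 k^2 + 3) m \<le> N\<close>.\<close>

lemma final_bound:
  fixes X :: real
  assumes k: "k \<ge> 2" and X: "X \<ge> 11" and m: "m = 2 ^ (18 * k\<^sup>2)"
  shows "7 * X + 162 * real k * real (odd_prod m) ^ 2 \<le> 4 powr (X ^ (3 ^ (k + 1)))"
proof -
  define N :: nat where "N = 2 ^ (20 * k\<^sup>2)"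
  define Y where "Y = X ^ (3 ^ (k + 1))"
  have k2: "2 * k \<le> k\<^sup>2"
    using k by (simp add: power2_eq_square)
  \<comment> \<open>The tower \<open>3 ^ (k + 1)\<close> enters here: it dominates
    \<open>20 k^2 / 3\<close>, and \<open>X\<close> exceeds the base
    \<open>8 = 2 ^ 3\<close>.\<close>
  have "real N \<le> 2 ^ (3 ^ (k + 2))"
    unfolding N_def using twenty_square_le_three_power[OF k] by (simp add: power_increasing)
  also have "\<dots> = 8 ^ (3 ^ (k + 1))"
    using power_mult[of "2::real" 3 "3 ^ (k + 1)"] by simp
  also have "\<dots> \<le> Y"
    unfolding Y_def using X by (intro power_mono) auto
  finally have NY: "real N \<le> Y" .
  have "162 * k \<le> 2 ^ 8 * 2 ^ k"
    by (intro mult_mono) (auto intro: less_imp_le less_exp)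
  also have "\<dots> = 2 ^ (8 + k)"
    by (simp add: power_add)
  also have "\<dots> \<le> 2 ^ (2 * m)"
  proof (rule power_increasing)
    have "18 * k\<^sup>2 < m"
      unfolding m by (rule less_exp)
    then show "8 + k \<le> 2 * m"
      using k k2 by linarith
  qed simp
  also have "\<dots> = 4 ^ m"
    by (simp add: power_mult)
  finally have 1: "162 * k \<le> 4 ^ m" .
  have base: "2 * m = 2 ^ (18 * k\<^sup>2 + 1)"
    by (simp add: m)
  have "odd_prod m ^ 2 \<le> ((2 * m) ^ m) ^ 2"
    by (intro power_mono odd_prod_le) simp
  also have "\<dots> = ((2 ^ (18 * k\<^sup>2 + 1)) ^ m) ^ 2"
    by (simp only: base)
  also have "\<dots> = (2 ^ 2) ^ ((18 * k\<^sup>2 + 1) * m)"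
    by (simp only: power_mult[symmetric]) (simp add: algebra_simps)
  also have "\<dots> = 4 ^ ((18 * k\<^sup>2 + 1) * m)"
    by simp
  finally have 2: "odd_prod m ^ 2 \<le> 4 ^ ((18 * k\<^sup>2 + 1) * m)" .
  have "2 * (162 * k * odd_prod m ^ 2) \<le> 4 ^ m * (4 ^ m * 4 ^ ((18 * k\<^sup>2 + 1) * m))"
  proof (intro mult_mono 1 2)
    have "(4::nat) ^ 1 \<le> 4 ^ m"
      unfolding m by (intro power_increasing) auto
    then show "2 \<le> (4::nat) ^ m" by simp
  qed auto
  also have "\<dots> = 4 ^ ((18 * k\<^sup>2 + 3) * m)"
    by (simp add: power_add[symmetric] algebra_simps)
  also have "\<dots> \<le> 4 ^ N"
  proof (rule power_increasing)
    have "18 * k\<^sup>2 + 3 \<le> 4 ^ k\<^sup>2"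
      using k k2 by (intro linear_le_power_four) linarith
    then have "(18 * k\<^sup>2 + 3) * m \<le> 4 ^ k\<^sup>2 * m"
      by (rule mult_right_mono) simp
    also have "(4::nat) ^ k\<^sup>2 = 2 ^ (2 * k\<^sup>2)"
      by (simp add: power_mult)
    also have "2 ^ (2 * k\<^sup>2) * m = N"
      unfolding m N_def by (simp flip: power_add)
    finally show "(18 * k\<^sup>2 + 3) * m \<le> N" .
  qed simp
  finally have "real (2 * (162 * k * odd_prod m ^ 2)) \<le> real (4 ^ N)"
    by (simp only: of_nat_le_iff)
  also have "real (4 ^ N) = 4 powr real N"
    by (simp add: powr_realpow)
  also have "\<dots> \<le> 4 powr Y"
    using NY by (intro powr_mono) auto
  finally have "2 * (162 * real k * real (odd_prod m) ^ 2) \<le> 4 powr Y"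
    by simp
  moreover have "14 * X \<le> 4 powr Y"
    unfolding Y_def
  proof (rule linear_le_four_powr)
    have "11\<^sup>2 \<le> X\<^sup>2"
      using X by (intro power_mono) auto
    then show "14 \<le> X\<^sup>2" by simp
    have "(3::nat) ^ 1 \<le> 3 ^ (k + 1)"
      by (intro power_increasing) auto
    then show "(3::nat) \<le> 3 ^ (k + 1)" by simp
  qed (use X in simp)
  ultimately show ?thesis
    unfolding Y_def by linarith
qed

section \<open>Evenness from the fifth term on\<close>

text \<open>Totients of numbers from 3 on are even. Unless \<open>k = 0\<close> and both starting
  values are at most 2, where the sequence is 2 from index 3 on, \<open>x 3 \<ge> 3\<close>, and
  this persists because the next term is at least \<open>2 + 1\<close>.\<close>

lemma totient_recurrence_even:
  fixes x :: "nat \<Rightarrow> nat"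
  assumes "even k" and "x 1 > 0" and "x 2 > 0"
    and rec: "\<And>n. n \<ge> 1 \<Longrightarrow> x (n + 2) = totient (x (n + 1)) + totient (x n) + k"
    and n: "n \<ge> 5"
  shows "even (x n) \<and> x n > 0"
proof (cases "k = 0 \<and> x 1 \<le> 2 \<and> x 2 \<le> 2")
  case True
  then have "x 1 \<in> {1, 2}" "x 2 \<in> {1, 2}"
    using assms(2,3) by auto
  then have "totient (x 1) = 1" "totient (x 2) = 1"
    by auto
  then have "x 3 = 2 \<and> x 4 = 2"
    using rec[of 1] rec[of 2] True totient_2 by (simp add: numeral_eq_Suc)
  then have "x (m + 3) = 2 \<and> x (m + 4) = 2" for m
  proof (induction m)
    case (Suc m)
    then show ?case
      using rec[of "m + 3"] True totient_2 by (simp add: numeral_eq_Suc)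
  qed simp
  from this[of "n - 3"] show ?thesis
    using n by simp
next
  case False
  have pos: "x m > 0" if "m \<ge> 1" for m
    using that
  proof (induction m rule: less_induct)
    case (less m)
    consider "m = 1" | "m = 2" | "m \<ge> 3"
      using less.prems by linarith
    then show ?case
    proof cases
      case 3
      then have "x m = totient (x (m - 1)) + totient (x (m - 2)) + k"
        using rec[of "m - 2"] by (simp add: Suc_diff_Suc numeral_eq_Suc)
      moreover have "x (m - 1) > 0"
        using 3 by (intro less.IH) auto
      ultimately show ?thesis by simp
    qed (use assms(2,3) in simp_all)
  qed
  have tot: "totient a \<ge> 1" if "a > 0" for a
    using that by (simp add: Suc_le_eq)
  have tot2: "totient a \<ge> 2" if "a \<ge> 3" for a
    using totient_gt_1[of a] that by simp
  have ge3: "x m \<ge> 3" if "m \<ge> 3" for m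
    using that
  proof (induction m rule: dec_induct)
    case base
    have x3: "x 3 = totient (x 2) + totient (x 1) + k"
      using rec[of 1] by (simp add: numeral_eq_Suc)
    have "k \<ge> 1 \<or> x 1 \<ge> 3 \<or> x 2 \<ge> 3"
      using False by linarith
    then show ?case
      using x3 tot[of "x 1"] tot[of "x 2"] tot2[of "x 1"] tot2[of "x 2"] assms(2,3) by linarith
  next
    case (step m)
    have "x (Suc m) = totient (x m) + totient (x (m - 1)) + k"
      using rec[of "m - 1"] step by (simp add: numeral_eq_Suc)
    then show ?case
      using tot2[of "x m"] tot[of "x (m - 1)"] pos[of "m - 1"] step by linarith
  qed
  have "x n = totient (x (n - 1)) + totient (x (n - 2)) + k"
    using rec[of "n - 2"] n by (simp add: Suc_diff_Suc numeral_eq_Suc)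
  moreover have "even (totient (x m))" if "m \<ge> 3" for m
    using ge3[OF that] by (intro totient_even) simp
  ultimately show ?thesis
    using n assms(1) pos[of n] by simp
qed

section \<open>The explicit bound and eventual periodicity\<close>

theorem theorem1p3:
  fixes k :: nat and x :: "nat \<Rightarrow> nat" and X :: real
  assumes "even k"
    and "x 1 > 0" and "x 2 > 0"
    and "\<And>n. n \<ge> 1 \<Longrightarrow> x (n + 2) = totient (x (n + 1)) + totient (x n) + k"
    and "X = (3 * real (x 1) + 5 * real (x 2) + 7 * real k) / 2"
  shows "(SUP n\<in>{1..}. ereal (real (x n))) \<le> ereal (4 powr (X ^ (3 ^ (k + 1))))
    \<and> (\<exists>T\<ge>1. \<forall>\<^sub>F n in sequentially. x (n + T) = x n)"
proof -
  define y where "y = (\<lambda>n. x (n + 5) div 2)"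
  note even_pos = totient_recurrence_even[OF assms(1-4)]
  have x_y: "x (n + 5) = 2 * y n" for n
    using even_pos[of "n + 5"] by (simp add: y_def)
  interpret halved_recurrence k y
  proof
    show "y n > 0" for n
      using even_pos[of "n + 5"] x_y[of n] by simp
    show "2 * y (n + 2) = totient (2 * y (n + 1)) + totient (2 * y n) + k" for n
      using assms(4)[of "n + 5"] by (simp flip: x_y)
  qed
  \<comment> \<open>Iterating up to \<open>x 6\<close> gives \<open>3 x 1 + 5 x 2 + 7 k\<close>,
    which is exactly \<open>2 X\<close>.\<close>
  have "x (n + 2) \<le> x (n + 1) + x n + k" if "n \<ge> 1" for n
    using assms(4)[OF that] totient_le[of "x (n + 1)"] totient_le[of "x n"] by linarith
  from this[of 1] this[of 2] this[of 3] this[of 4]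
  have "x 3 \<le> x 2 + x 1 + k" "x 4 \<le> x 3 + x 2 + k" "x 5 \<le> x 4 + x 3 + k" "x 6 \<le> x 5 + x 4 + k"
    by (simp_all add: numeral_eq_Suc)
  then have small: "real (x 1) \<le> 2 * X" "real (x 2) \<le> 2 * X" "real (x 3) \<le> 2 * X"
    "real (x 4) \<le> 2 * X" "real (x 5) \<le> 2 * X" "real (x 6) \<le> 2 * X"
    unfolding assms(5) by simp_all
  have X4: "X \<ge> 4" and X11: "k \<ge> 2 \<Longrightarrow> X \<ge> 11"
    using assms(2,3) unfolding assms(5) by simp_all
  \<comment> \<open>\<open>y 0\<close> and \<open>y 1\<close> are half of \<open>x 5\<close> and
    \<open>x 6\<close>, hence at most \<open>X\<close>.\<close>
  have "U 0 \<le> 3 * int (y 0) + 4 * int (y 1)"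
    unfolding U_def d_def by (cases "y 0 \<le> y 1") (simp_all add: abs_if)
  then have "real_of_int (U 0) \<le> real_of_int (3 * int (y 0) + 4 * int (y 1))"
    by (simp only: of_int_le_iff)
  also have "\<dots> \<le> 7 * X"
    using small(5,6) x_y[of 0] x_y[of 1] by simp
  finally have U0: "real_of_int (U 0) \<le> 7 * X" .
  have U_bound: "real_of_int (U n) \<le> 4 powr (X ^ (3 ^ (k + 1)))" for n
  proof (cases "k = 0")
    case True
    \<comment> \<open>For \<open>k = 0\<close> the potential never increases.\<close>
    have "real_of_int (U n) \<le> real_of_int (U 0)"
      using U_add_le[of 0 n] True by simp
    also have "\<dots> \<le> 7 * X"
      by (rule U0)
    also have "\<dots> \<le> 4 powr (X ^ (3 ^ (k + 1)))"
    proof (rule linear_le_four_powr)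
      have "4\<^sup>2 \<le> X\<^sup>2"
        using X4 by (intro power_mono) auto
      then show "7 \<le> X\<^sup>2" by simp
    qed (use X4 True in simp_all)
    finally show ?thesis .
  next
    case False
    then have k: "k \<ge> 2"
      using assms(1) by presburger
    define m :: nat where "m = 2 ^ (18 * k\<^sup>2)"
    define P where "P = odd_prod m"
    have "6 * k \<le> 18 * k\<^sup>2"
      using k by (simp add: power2_eq_square)
    also have "18 * k\<^sup>2 < m"
      unfolding m_def by (rule less_exp)
    also have "m \<le> P"
      unfolding P_def by (rule odd_prod_ge)
    finally have P: "6 * k < P" .
    \<comment> \<open>Since \<open>U 0 \<ge> 0\<close>, this sum serves as \<open>C\<close> for both
      conditions of \<open>U_bounded\<close>.\<close>
    have "U n \<le> (U 0 + 140 * int k * int P ^ 2 + 2 * int k) + 2 * int k * int (9 * P + 1)"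
    proof (rule U_bounded)
      show "k > 0" "odd P" "16 * k + 2 < 3 * P"
        using k P odd_odd_prod by (simp_all add: P_def)
      show "8 * k * (6 * k + 1) * totient P < 9 * P"
        unfolding P_def by (rule odd_prod_density[OF k m_def])
      have "2 * int (y 0) \<le> U 0"
        by (rule y_le_U)
      then show "140 * int k * int P ^ 2 + 2 * int k \<le> U 0 + 140 * int k * int P ^ 2 + 2 * int k"
        by linarith
    qed simp
    also have "\<dots> = U 0 + int k * (140 * int P ^ 2 + 18 * int P + 4)"
      by (simp add: algebra_simps)
    also have "\<dots> \<le> U 0 + int k * (162 * int P ^ 2)"
    proof -
      have "int P * 1 \<le> int P * int P"
        using P by (intro mult_left_mono) auto
      then have "140 * int P ^ 2 + 18 * int P + 4 \<le> 162 * int P ^ 2"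
        unfolding power2_eq_square using P by linarith
      then show ?thesis
        by (intro add_left_mono mult_left_mono) auto
    qed
    finally have "real_of_int (U n) \<le> real_of_int (U 0 + int k * (162 * int P ^ 2))"
      by (simp only: of_int_le_iff)
    also have "\<dots> \<le> 7 * X + 162 * real k * real P ^ 2"
      using U0 by simp
    also have "\<dots> \<le> 4 powr (X ^ (3 ^ (k + 1)))"
      unfolding P_def by (rule final_bound[OF k X11[OF k] m_def])
    finally show ?thesis .
  qed
  have bound: "real (x n) \<le> 4 powr (X ^ (3 ^ (k + 1)))" if "n \<ge> 1" for n
  proof (cases "n \<ge> 5")
    case True
    have "real (x n) = real_of_int (2 * int (y (n - 5)))"
      using x_y[of "n - 5"] True by simp
    also have "\<dots> \<le> real_of_int (U (n - 5))"
      by (simp only: of_int_le_iff y_le_U)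
    also note U_bound
    finally show ?thesis .
  next
    case False
    then have "n \<in> {1, 2, 3, 4}"
      using that by auto
    then have "real (x n) \<le> 2 * X"
      using small by auto
    also have "\<dots> \<le> 4 powr (X ^ (3 ^ (k + 1)))"
    proof (rule linear_le_four_powr)
      have "4\<^sup>2 \<le> X\<^sup>2"
        using X4 by (intro power_mono) auto
      then show "2 \<le> X\<^sup>2" by simp
      show "3 \<le> (3::nat) ^ (k + 1)" by simp
    qed (rule X4)
    finally show ?thesis .
  qed
  have "\<exists>T\<ge>1. \<forall>\<^sub>F n in sequentially. x (n + T) = x n"
  proof (rule second_order_recurrence_eventually_periodic)
    show "x (n + 2) = totient (x (n + 1)) + totient (x n) + k" if "n \<ge> 1" for n
      by (rule assms(4)[OF that])
    show "x n \<le> nat \<lfloor>4 powr (X ^ (3 ^ (k + 1)))\<rfloor>" if "n \<ge> 1" for n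
      using bound[OF that] by (simp add: le_nat_floor)
  qed
  moreover have "(SUP n\<in>{1..}. ereal (real (x n))) \<le> ereal (4 powr (X ^ (3 ^ (k + 1))))"
    using bound by (intro SUP_least) simp
  ultimately show ?thesis by blast
qed

end
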